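(* (Soundness of CPPL resolution.) Let $S$ and $S'$ be sets of CPPL sentences. If $S \vdash^r S'$, then $S \models S'$.
   Context: Let $\mathcal{P}$ be a finite or countably infinite set of propositional variables. PPL formulas form the smallest set containing $\mathcal{P}$ such that whenever $n\in\mathbb{N}$ and $\alpha,\beta$ are formulas, the strings $n(\alpha)$, $\neg\alpha$, $(\alpha+\beta)$ are formulas. A literal $\lambda$ is $p$ or $\neg p$ with $p\in\mathcal{P}$; a pseudo-literal is $n\lambda$; a formula is in normal form if it is a sum of pseudo-literals. An interpretation is a subset $I\subseteq\mathcal{P}$, extended to $I:\text{formulas}\to\mathbb{Z}^2$ by $I(p)=(1,0)$ if $p\in I$ and $(0,1)$ otherwise, $I(n\beta)=(nz,nz')$ where $I(\beta)=(z,z')$, $I(\neg\beta)=(z',z)$ where $I(\beta)=(z,z')$, and $I(\beta_1+\beta_2)=I(\beta_1)+I(\beta_2)$ componentwise. A CPPL sentence is $\varphi^{(\bowtie,n)}$ with $\varphi$ a formula, $\bowtie\in\{>,\geq,=,<,\leq\}$, $n\in\mathbb{N}$ (and also $\sim\Phi$ for a sentence $\Phi$). $I\models\varphi^{(\bowtie,n)}$ iff $I(\varphi)=(m,l)$ with $m\bowtie n$; $I\models S$ iff $I\models\Phi$ for all $\Phi\in S$; $S\models S'$ iff every $I$ with $I\models S$ satisfies $I\models S'$. A sentence is standard if it has the form $(\sum_{i=1}^k n_i\lambda_i)^{(\geq,n)}$. For a normal-form formula $\beta=\sum_{i=1}^k m_i\lambda_i$, $|\beta|=\sum_i m_i$ (coefficient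 sum) and $\neg\beta=\sum_i m_i\neg\lambda_i$. The CPPL resolution proof system has two rules: Rule I: if $S\subseteq S'$ then $S'\vdash^r S$; Rule II: if $S\vdash^r \{(\varphi_1+\beta)^{(\geq,n_1)},(\varphi_2+\neg\beta)^{(\geq,n_2)}\}$ then $S\vdash^r\{(\varphi_1+\varphi_2)^{(\geq,n_1+n_2-|\beta|)}\}$ (formulas in normal form). $S\vdash^r S'$ means this statement is obtained by finitely many applications of these rules. *)

theory Defs
  imports "HOL-Library.Countable"
begin

text \<open>The type of propositional variables plays the role of the set \<open>\<P>\<close>; the theorem
  requires it to be of class \<^class>\<open>countable\<close>, i.e. finite or countably infinite.\<close>

datatype 'p formula =
    Var 'p
  | Scale nat "'p formula"
  | Neg "'p formula"
  | Plus "'p formula" "'p formula"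

fun interp :: "'p set \<Rightarrow> 'p formula \<Rightarrow> int \<times> int" where
  "interp I (Var p) = (if p \<in> I then (1, 0) else (0, 1))"
| "interp I (Scale n \<alpha>) = (case interp I \<alpha> of (z, z') \<Rightarrow> (int n * z, int n * z'))"
| "interp I (Neg \<alpha>) = (case interp I \<alpha> of (z, z') \<Rightarrow> (z', z))"
| "interp I (Plus \<alpha> \<beta>) =
     (case (interp I \<alpha>, interp I \<beta>) of ((z, z'), (w, w')) \<Rightarrow> (z + w, z' + w'))"

datatype comparison = Greater | GreaterEq | Equal | Less | LessEq

fun holds :: "comparison \<Rightarrow> int \<Rightarrow> int \<Rightarrow> bool" where
  "holds Greater m n \<longleftrightarrow> m > n"
| "holds GreaterEq m n \<longleftrightarrow> m \<ge> n"
| "holds Equal m n \<longleftrightarrow> m = n"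
| "holds Less m n \<longleftrightarrow> m < n"
| "holds LessEq m n \<longleftrightarrow> m \<le> n"

text \<open>\<open>Threshold \<phi> c n\<close> is the sentence \<open>\<phi>\<close> with superscript \<open>(c, n)\<close>;
  \<open>SNot \<Phi>\<close> is \<open>\<sim>\<Phi>\<close>.\<close>

datatype 'p sentence =
    Threshold "'p formula" comparison nat
  | SNot "'p sentence"

fun satisfies :: "'p set \<Rightarrow> 'p sentence \<Rightarrow> bool" where
  "satisfies I (Threshold \<phi> c n) \<longleftrightarrow> (case interp I \<phi> of (m, l) \<Rightarrow> holds c m (int n))"
| "satisfies I (SNot \<Phi>) \<longleftrightarrow> \<not> satisfies I \<Phi>"

definition satisfies_all :: "'p set \<Rightarrow> 'p sentence set \<Rightarrow> bool" where
  "satisfies_all I S \<longleftrightarrow> (\<forall>\<Phi>\<in>S. satisfies I \<Phi>)"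

definition entails :: "'p sentence set \<Rightarrow> 'p sentence set \<Rightarrow> bool" (infix "\<TTurnstile>" 50) where
  "S \<TTurnstile> S' \<longleftrightarrow> (\<forall>I. satisfies_all I S \<longrightarrow> satisfies_all I S')"

inductive literal :: "'p formula \<Rightarrow> bool" where
  "literal (Var p)"
| "literal (Neg (Var p))"

text \<open>Sums are binary, so a sum of pseudo-literals may be bracketed in any way.\<close>

inductive normal_form :: "'p formula \<Rightarrow> bool" where
  pseudo_literal: "literal l \<Longrightarrow> normal_form (Scale n l)"
| sum: "normal_form \<alpha> \<Longrightarrow> normal_form \<beta> \<Longrightarrow> normal_form (Plus \<alpha> \<beta>)"

text \<open>The next three functions are only meant for literals and for normal forms, respectively;
  they are unspecified elsewhere. The negation of the literal \<open>\<not>p\<close> is the literal \<open>p\<close>,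
  so that the negation of a normal form is again a normal form.\<close>

fun neg_literal :: "'p formula \<Rightarrow> 'p formula" where
  "neg_literal (Var p) = Neg (Var p)"
| "neg_literal (Neg (Var p)) = Var p"

fun neg_nf :: "'p formula \<Rightarrow> 'p formula" where
  "neg_nf (Scale m l) = Scale m (neg_literal l)"
| "neg_nf (Plus \<alpha> \<beta>) = Plus (neg_nf \<alpha>) (neg_nf \<beta>)"

fun coeff_sum :: "'p formula \<Rightarrow> nat" where
  "coeff_sum (Scale m l) = m"
| "coeff_sum (Plus \<alpha> \<beta>) = coeff_sum \<alpha> + coeff_sum \<beta>"

text \<open>The condition \<open>coeff_sum \<beta> \<le> n\<^sub>1 + n\<^sub>2\<close> in Rule II says that the number in the
  conclusion is a natural number, as the syntax of sentences demands; the subtraction is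
  therefore never truncated.\<close>

inductive derives :: "'p sentence set \<Rightarrow> 'p sentence set \<Rightarrow> bool" (infix "\<turnstile>\<^sup>r" 50) where
  rule_I: "S \<subseteq> S' \<Longrightarrow> S' \<turnstile>\<^sup>r S"
| rule_II: "S \<turnstile>\<^sup>r {Threshold (Plus \<phi>\<^sub>1 \<beta>) GreaterEq n\<^sub>1,
                  Threshold (Plus \<phi>\<^sub>2 (neg_nf \<beta>)) GreaterEq n\<^sub>2} \<Longrightarrow>
    normal_form \<phi>\<^sub>1 \<Longrightarrow> normal_form \<phi>\<^sub>2 \<Longrightarrow> normal_form \<beta> \<Longrightarrow>
    coeff_sum \<beta> \<le> n\<^sub>1 + n\<^sub>2 \<Longrightarrow>
    S \<turnstile>\<^sup>r {Threshold (Plus \<phi>\<^sub>1 \<phi>\<^sub>2) GreaterEq (n\<^sub>1 + n\<^sub>2 - coeff_sum \<beta>)}"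

end

theory Submission
  imports Defs
begin

text \<open>Under any interpretation, exactly one of a literal and its negation has first component
  1; the other has 0. By linearity, the first components of \<beta> and its negation add up to the
  constant |\<beta>| (\<open>fst_interp_neg_nf\<close>). Adding the two premises of Rule II and
  cancelling this constant yields the resolvent (\<open>satisfies_resolvent\<close>). Soundness
  follows by induction on the derivation, Rule I being monotonicity.\<close>

lemma fst_interp_neg_literal:
  assumes "literal l"
  shows "fst (interp I l) + fst (interp I (neg_literal l)) = 1"
  using assms by cases auto

text \<open>Both sides are additive over \<open>Plus\<close>, and \<open>neg_nf\<close> keeps each
  coefficient while flipping its literal, so a pseudo-literal with coefficient n contributes exactly
  n.\<close>

lemma fst_interp_neg_nf:
  assumes "normal_form \<beta>"
  shows "fst (interp I \<beta>) + fst (interp I (neg_nf \<beta>)) = int (coeff_sum \<beta>)"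
  using assms
proof induction
  case (pseudo_literal l n)
  have "fst (interp I (Scale n l)) + fst (interp I (neg_nf (Scale n l)))
      = int n * (fst (interp I l) + fst (interp I (neg_literal l)))"
    by (simp add: case_prod_unfold distrib_left)
  with fst_interp_neg_literal[OF pseudo_literal] show ?case
    by simp
next
  case (sum \<alpha> \<beta>)
  then show ?case
    by (simp add: case_prod_unfold)
qed

lemma satisfies_GreaterEq_iff:
  "satisfies I (Threshold \<phi> GreaterEq n) \<longleftrightarrow> int n \<le> fst (interp I \<phi>)"
  by (simp add: case_prod_unfold)

lemma fst_interp_Plus:
  "fst (interp I (Plus \<alpha> \<beta>)) = fst (interp I \<alpha>) + fst (interp I \<beta>)"
  by (simp add: case_prod_unfold)

lemma satisfies_resolvent:
  assumes "satisfies I (Threshold (Plus \<phi>\<^sub>1 \<beta>) GreaterEq n\<^sub>1)"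
    and "satisfies I (Threshold (Plus \<phi>\<^sub>2 (neg_nf \<beta>)) GreaterEq n\<^sub>2)"
    and "normal_form \<beta>" and "coeff_sum \<beta> \<le> n\<^sub>1 + n\<^sub>2"
  shows "satisfies I (Threshold (Plus \<phi>\<^sub>1 \<phi>\<^sub>2) GreaterEq (n\<^sub>1 + n\<^sub>2 - coeff_sum \<beta>))"
  \<comment> \<open>The bound \<open>assms(4)\<close> makes the subtraction on naturals agree with
    the one on integers.\<close>
  using assms(1,2,4) fst_interp_neg_nf[OF assms(3), of I]
  unfolding satisfies_GreaterEq_iff fst_interp_Plus by linarith

theorem theorem3p1:
  fixes S S' :: "'p::countable sentence set"
  assumes "S \<turnstile>\<^sup>r S'"
  shows "S \<TTurnstile> S'"
  using assms
proof induction
  case (rule_I S S')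
  then show ?case
    by (auto simp: entails_def satisfies_all_def)
next
  case (rule_II S \<phi>\<^sub>1 \<beta> n\<^sub>1 \<phi>\<^sub>2 n\<^sub>2)
  then show ?case
    \<comment> \<open>The interpretation is left open because entailment quantifies over it; the
      induction hypothesis gives both premises at the same one.\<close>
    using satisfies_resolvent[of _ \<phi>\<^sub>1 \<beta> n\<^sub>1 \<phi>\<^sub>2 n\<^sub>2]
    unfolding entails_def satisfies_all_def by blast
qed

end
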